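(* Let $K$ be a finite field, let $S=K[t_1,\ldots,t_s]$, let $X=\{P_1,\ldots,P_m\}\subset K^s$ be a set of $m=|X|\geq 2$ points, and let $I=I(X)\subset S$ be the vanishing ideal of $X$. Fix a monomial order $\prec$ on $S$ and let $t^e\in\Delta_\prec(I)$ be an essential standard monomial. Then for any $\Gamma_1,\Gamma_2\subset\Delta_\prec(I)$ satisfying (1) $|\Gamma_1|+|\Gamma_2|=|X|$, and (2) $t^e$ does not appear in $\overline{u}$ for any $u\in\Gamma_1\Gamma_2$, we have $$\beta\cdot\mathcal{L}(\Gamma_1)_X=\left(\mathcal{L}(\Gamma_2)_X\right)^\perp$$ for some $\beta=(\beta_1,\ldots,\beta_m)\in(K^* )^m$. Moreover, $\beta_i$ is the coefficient of $t^e$ in the $i$-th standard indicator function $f_i$, for $i=1,\ldots,m$.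
   Context: $I(X)$ is the ideal of all polynomials vanishing on $X$; $\Delta_\prec(I)$ is the set of standard monomials of $S/I$ (monomials not in $\mathrm{in}_\prec(I)$), and $K\Delta_\prec(I)$ is its $K$-span. For $u\in S$, $\overline{u}\in K\Delta_\prec(I)$ denotes the unique element of $K\Delta_\prec(I)$ congruent to $u$ modulo $I$. A monomial appears in a polynomial if its coefficient there is nonzero. For each $i$, the $i$-th standard indicator function $f_i$ is the unique polynomial in $K\Delta_\prec(I)$ with $f_i(P_i)=1$ and $f_i(P_j)=0$ for $j\ne i$. A standard monomial $t^e\in\Delta_\prec(I)$ is essential if it appears in each of $f_1,\ldots,f_m$. For $\Gamma\subset\Delta_\prec(I)$, $\mathcal{L}(\Gamma)$ is the $K$-span of $\Gamma$. For a finite-dimensional linear subspace $\mathcal{L}\subset S$, $\mathcal{L}_X=\{(f(P_1),\ldots,f(P_m)): f\in\mathcal{L}\}\subset K^m$. $\Gamma_1\Gamma_2=\{u_1u_2\in S: u_1\in\Gamma_1,u_2\in\Gamma_2\}$. For a linear code $C\subset K^m$, $C^\perp$ is its dual for the ordinary inner product, and $\beta\cdot C=\{(\beta_1c_1,\ldots,\beta_mc_m): (c_1,\ldots,c_m)\in C\}$. $K^*=K\setminus\{0\}$. *)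

theory Defs
  imports "HOL-Library.Poly_Mapping" "HOL-Analysis.Finite_Cartesian_Product"
begin

text \<open>
  Polynomials over 'a in the variables 't are finitely supported maps from exponent vectors
  to coefficients. A monomial is represented by its exponent vector \<open>a\<close>, so sets of monomials
  are sets of exponent vectors; \<open>monom a\<close> is the monomial as an element of the polynomial ring.
\<close>

type_synonym 't expvec = "'t \<Rightarrow>\<^sub>0 nat"
type_synonym ('t, 'a) mpoly = "'t expvec \<Rightarrow>\<^sub>0 'a"

definition monom :: "'t expvec \<Rightarrow> ('t, 'a::comm_ring_1) mpoly" where
  "monom a = Poly_Mapping.single a 1"

definition eval :: "('t::finite, 'a::comm_ring_1) mpoly \<Rightarrow> 'a ^ 't \<Rightarrow> 'a" where
  "eval f x = (\<Sum>a\<in>Poly_Mapping.keys f.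
     Poly_Mapping.lookup f a * (\<Prod>i\<in>UNIV. (x $ i) ^ Poly_Mapping.lookup a i))"

definition appears_in :: "'t expvec \<Rightarrow> ('t, 'a::comm_ring_1) mpoly \<Rightarrow> bool" where
  "appears_in a f \<longleftrightarrow> Poly_Mapping.lookup f a \<noteq> 0"

definition poly_scale :: "'a::comm_ring_1 \<Rightarrow> ('t, 'a) mpoly \<Rightarrow> ('t, 'a) mpoly" where
  "poly_scale c f = Poly_Mapping.map (\<lambda>x. c * x) f"

lemma lookup_poly_scale [simp]:
  "Poly_Mapping.lookup (poly_scale c f) a = c * Poly_Mapping.lookup f a"
  by (simp add: poly_scale_def map.rep_eq when_def)

lemma vector_space_poly_scale:
  "vector_space (poly_scale :: 'a::field \<Rightarrow> ('t, 'a) mpoly \<Rightarrow> ('t, 'a) mpoly)"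
  by unfold_locales (auto intro!: poly_mapping_eqI simp: lookup_add algebra_simps)

lemma module_times: "module (\<lambda>(r::'r::comm_ring_1) x. r * x)"
  by unfold_locales (auto simp: algebra_simps)

definition lin_span :: "'t expvec set \<Rightarrow> ('t, 'a::field) mpoly set" where
  "lin_span \<Gamma> = module.span poly_scale (monom ` \<Gamma>)"

definition ideal_gen :: "'r::comm_ring_1 set \<Rightarrow> 'r set" where
  "ideal_gen A = module.span (\<lambda>r x. r * x) A"

text \<open>The strict order on exponent vectors; the well-ordering condition is part of the notion.\<close>

definition monomial_order :: "('t expvec \<Rightarrow> 't expvec \<Rightarrow> bool) \<Rightarrow> bool" where
  "monomial_order prec \<longleftrightarrow> irreflp prec \<and> transp prec \<and> totalp prec \<and> wfp prec \<and>
     (\<forall>a b c. prec a b \<longrightarrow> prec (a + c) (b + c))"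

definition lead_exp ::
  "('t expvec \<Rightarrow> 't expvec \<Rightarrow> bool) \<Rightarrow> ('t, 'a::comm_ring_1) mpoly \<Rightarrow> 't expvec" where
  "lead_exp prec f = (THE a. appears_in a f \<and> (\<forall>b. appears_in b f \<longrightarrow> b = a \<or> prec b a))"

definition initial_ideal ::
  "('t expvec \<Rightarrow> 't expvec \<Rightarrow> bool) \<Rightarrow> ('t, 'a::comm_ring_1) mpoly set \<Rightarrow> ('t, 'a) mpoly set" where
  "initial_ideal prec I = ideal_gen {monom (lead_exp prec f) | f. f \<in> I \<and> f \<noteq> 0}"

definition std_monoms ::
  "('t expvec \<Rightarrow> 't expvec \<Rightarrow> bool) \<Rightarrow> ('t, 'a::comm_ring_1) mpoly set \<Rightarrow> 't expvec set" where
  "std_monoms prec I = {a. monom a \<notin> initial_ideal prec I}"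

definition normal_form ::
  "('t expvec \<Rightarrow> 't expvec \<Rightarrow> bool) \<Rightarrow> ('t, 'a::field) mpoly set \<Rightarrow> ('t, 'a) mpoly \<Rightarrow> ('t, 'a) mpoly" where
  "normal_form prec I u = (THE r. r \<in> lin_span (std_monoms prec I) \<and> u - r \<in> I)"

definition vanishing_ideal :: "('a::comm_ring_1 ^ 't::finite) set \<Rightarrow> ('t, 'a) mpoly set" where
  "vanishing_ideal X = {f. \<forall>x\<in>X. eval f x = 0}"

text \<open>
  The points of \<open>X\<close> are enumerated without repetition by a finite index type 'm, that is by an
  injective \<open>P\<close> with \<open>X = range P\<close>; correspondingly \<open>K\<^sup>m\<close> is \<open>'a ^ 'm\<close>.
\<close>

definition std_indicator ::
  "('t expvec \<Rightarrow> 't expvec \<Rightarrow> bool) \<Rightarrow> ('m \<Rightarrow> 'a::field ^ 't::finite) \<Rightarrow> 'm \<Rightarrow> ('t, 'a) mpoly" where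
  "std_indicator prec P i =
     (THE f. f \<in> lin_span (std_monoms prec (vanishing_ideal (range P))) \<and>
        eval f (P i) = 1 \<and> (\<forall>j. j \<noteq> i \<longrightarrow> eval f (P j) = 0))"

definition essential_monom ::
  "('t expvec \<Rightarrow> 't expvec \<Rightarrow> bool) \<Rightarrow> ('m \<Rightarrow> 'a::field ^ 't::finite) \<Rightarrow> 't expvec \<Rightarrow> bool" where
  "essential_monom prec P e \<longleftrightarrow>
     e \<in> std_monoms prec (vanishing_ideal (range P)) \<and>
     (\<forall>i. appears_in e (std_indicator prec P i))"

definition eval_code ::
  "('m \<Rightarrow> 'a::comm_ring_1 ^ 't::finite) \<Rightarrow> ('t, 'a) mpoly set \<Rightarrow> ('a ^ 'm::finite) set" where
  "eval_code P L = {(\<chi> i. eval f (P i)) | f. f \<in> L}"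

definition dual_code :: "('a::comm_ring_1 ^ 'm::finite) set \<Rightarrow> ('a ^ 'm) set" where
  "dual_code C = {b. \<forall>c\<in>C. (\<Sum>i\<in>UNIV. b $ i * c $ i) = 0}"

definition scale_code :: "'a::comm_ring_1 ^ 'm::finite \<Rightarrow> ('a ^ 'm) set \<Rightarrow> ('a ^ 'm) set" where
  "scale_code \<beta> C = {(\<chi> i. \<beta> $ i * c $ i) | c. c \<in> C}"

definition monom_products :: "'t expvec set \<Rightarrow> 't expvec set \<Rightarrow> ('t, 'a::comm_ring_1) mpoly set" where
  "monom_products \<Gamma>1 \<Gamma>2 = {monom a * monom b | a b. a \<in> \<Gamma>1 \<and> b \<in> \<Gamma>2}"

end

theory Submission
  imports Defs
begin

text \<open>
  Write \<open>\<Delta>\<close> for the set of standard monomials of the vanishing ideal of the points \<open>P\<close>.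
  The proof rests on two facts about evaluation at these points.

  First, evaluation is a linear bijection from the span of \<open>\<Delta>\<close> onto \<open>K\<^sup>m\<close>. It is injective
  because a nonzero element of an ideal has a leading monomial that is not standard
  (\<open>lin_span_std_monoms_Int_ideal\<close>), and surjective because every vector of values is
  interpolated by some polynomial, which can be reduced modulo the ideal to a combination of
  standard monomials (\<open>congruent_to_std\<close>). So the standard indicator functions \<open>f\<^sub>i\<close> exist and
  form a basis of the span of \<open>\<Delta>\<close>, dual to the evaluations at the points.

  Second, expanding a normal form in this basis and comparing the coefficients of \<open>t\<^sup>e\<close> shows
  that, with \<open>\<beta>\<^sub>i\<close> the coefficient of \<open>t\<^sup>e\<close> in \<open>f\<^sub>i\<close>, the coefficient of \<open>t\<^sup>e\<close> in the normal form
  of any \<open>u\<close> is \<open>\<Sum>\<^sub>i \<beta>\<^sub>i u(P\<^sub>i)\<close> (\<open>coeff_normal_form\<close>). For a product \<open>u = u\<^sub>1 u\<^sub>2\<close> of monomials from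
  \<open>\<Gamma>1\<close> and \<open>\<Gamma>2\<close> the hypothesis says that this coefficient vanishes, which is exactly the
  orthogonality of \<open>\<beta> \<cdot> u\<^sub>1\<close> and \<open>u\<^sub>2\<close> as vectors of values. Hence \<open>\<beta> \<cdot> L(\<Gamma>1)\<^sub>X\<close> lies in the dual
  of \<open>L(\<Gamma>2)\<^sub>X\<close>.

  Equality is a dimension count. As \<open>t\<^sup>e\<close> is essential, multiplication by \<open>\<beta>\<close> is injective, so
  the left side has dimension \<open>|\<Gamma>1|\<close>; the dual has dimension at most \<open>m - |\<Gamma>2|\<close>, and the
  two numbers agree. As \<open>K\<close> is finite, dimensions are compared through the numbers of elements
  of the codes (\<open>card_eval_code\<close>, \<open>card_dual_eval_code_le\<close>).
\<close>

section \<open>Polynomials as linear combinations of monomials\<close>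

interpretation mpoly: vector_space "poly_scale :: 'a::field \<Rightarrow> ('t, 'a) mpoly \<Rightarrow> ('t, 'a) mpoly"
  by (rule vector_space_poly_scale)

text \<open>
  In a commutative ring regarded as a module over itself the submodules are the ideals, so
  \<open>idl.subspace I\<close> below says that \<open>I\<close> is an ideal.
\<close>
interpretation idl: module "\<lambda>(r::'r::comm_ring_1) x. r * x"
  by (rule module_times)

text \<open>
  In this module the rule below is associativity read from right to left, which as a rewrite
  rule undoes every normalization of products by \<open>mult_ac\<close> or \<open>algebra_simps\<close>.
\<close>
declare idl.scale_scale [simp del]

lemma poly_mapping_sum_single:
  "f = (\<Sum>a\<in>Poly_Mapping.keys f. Poly_Mapping.single a (Poly_Mapping.lookup f a))"
  by (rule poly_mapping_eqI)
    (auto simp: lookup_sum lookup_single when_def in_keys_iff)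

lemma poly_scale_eq_mult: "poly_scale c f = Poly_Mapping.single 0 c * f"
  by (simp add: poly_scale_def mult_map_scale_conv_mult)

lemma poly_scale_monom: "poly_scale c (monom a) = Poly_Mapping.single a c"
  by (rule poly_mapping_eqI) (auto simp: monom_def lookup_single when_def)

lemma lin_span_iff_keys:
  fixes f :: "('t, 'a::field) mpoly"
  shows "f \<in> lin_span \<Gamma> \<longleftrightarrow> Poly_Mapping.keys f \<subseteq> \<Gamma>"
proof
  have "lin_span \<Gamma> \<subseteq> {f :: ('t, 'a) mpoly. Poly_Mapping.keys f \<subseteq> \<Gamma>}"
    unfolding lin_span_def
  proof (rule mpoly.span_minimal)
    show "monom ` \<Gamma> \<subseteq> {f :: ('t, 'a) mpoly. Poly_Mapping.keys f \<subseteq> \<Gamma>}"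
      by (auto simp: monom_def)
    show "mpoly.subspace {f :: ('t, 'a) mpoly. Poly_Mapping.keys f \<subseteq> \<Gamma>}"
    proof (rule mpoly.subspaceI)
      fix f g :: "('t, 'a) mpoly"
      assume "f \<in> {f. Poly_Mapping.keys f \<subseteq> \<Gamma>}" "g \<in> {f. Poly_Mapping.keys f \<subseteq> \<Gamma>}"
      then show "f + g \<in> {f. Poly_Mapping.keys f \<subseteq> \<Gamma>}"
        using keys_add[of f g] by auto
    qed (auto simp: in_keys_iff subset_iff)
  qed
  then show "f \<in> lin_span \<Gamma> \<Longrightarrow> Poly_Mapping.keys f \<subseteq> \<Gamma>" by auto
next
  assume "Poly_Mapping.keys f \<subseteq> \<Gamma>"
  then have "(\<Sum>a\<in>Poly_Mapping.keys f. poly_scale (Poly_Mapping.lookup f a) (monom a)) \<in> lin_span \<Gamma>"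
    unfolding lin_span_def
    by (intro mpoly.span_sum mpoly.span_scale mpoly.span_base) auto
  then show "f \<in> lin_span \<Gamma>"
    by (simp only: poly_scale_monom poly_mapping_sum_single[symmetric])
qed

lemma subspace_lin_span: "mpoly.subspace (lin_span \<Gamma>)"
  by (simp add: lin_span_def mpoly.subspace_span)

lemma card_lin_span:
  assumes "finite \<Gamma>"
  shows "card (lin_span \<Gamma> :: ('t, 'a::{field,finite}) mpoly set) = CARD('a) ^ card \<Gamma>"
proof -
  have "bij_betw (\<lambda>f. restrict (Poly_Mapping.lookup f) \<Gamma>)
          (lin_span \<Gamma> :: ('t, 'a) mpoly set) (\<Gamma> \<rightarrow>\<^sub>E UNIV)"
  proof (rule bij_betwI')
    fix f g :: "('t, 'a) mpoly"
    assume f: "f \<in> lin_span \<Gamma>" and g: "g \<in> lin_span \<Gamma>"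
    show "(restrict (Poly_Mapping.lookup f) \<Gamma> = restrict (Poly_Mapping.lookup g) \<Gamma>) = (f = g)"
    proof
      assume eq: "restrict (Poly_Mapping.lookup f) \<Gamma> = restrict (Poly_Mapping.lookup g) \<Gamma>"
      have "Poly_Mapping.lookup f a = Poly_Mapping.lookup g a" for a
      proof (cases "a \<in> \<Gamma>")
        case True
        then show ?thesis using fun_cong[OF eq, of a] by simp
      next
        case False
        then show ?thesis using f g by (metis lin_span_iff_keys in_keys_iff subsetD)
      qed
      then show "f = g" by (rule poly_mapping_eqI)
    qed simp
  next
    fix f :: "('t, 'a) mpoly"
    show "restrict (Poly_Mapping.lookup f) \<Gamma> \<in> \<Gamma> \<rightarrow>\<^sub>E UNIV" by simp
  next
    fix h :: "'t expvec \<Rightarrow> 'a"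
    assume h: "h \<in> \<Gamma> \<rightarrow>\<^sub>E UNIV"
    define f where "f = (\<Sum>a\<in>\<Gamma>. Poly_Mapping.single a (h a))"
    have lk: "Poly_Mapping.lookup f a = (if a \<in> \<Gamma> then h a else 0)" for a
      using assms by (simp add: f_def lookup_sum lookup_single when_def)
    have "f \<in> lin_span \<Gamma>"
      by (auto simp: lin_span_iff_keys in_keys_iff lk split: if_splits)
    moreover have "h = restrict (Poly_Mapping.lookup f) \<Gamma>"
      using h by (auto simp: fun_eq_iff lk PiE_def extensional_def)
    ultimately show "\<exists>f\<in>lin_span \<Gamma>. h = restrict (Poly_Mapping.lookup f) \<Gamma>" by blast
  qed
  then have "card (lin_span \<Gamma> :: ('t, 'a) mpoly set) = card (\<Gamma> \<rightarrow>\<^sub>E (UNIV :: 'a set))"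
    by (rule bij_betw_same_card)
  then show ?thesis using assms by (simp add: card_funcsetE)
qed

section \<open>Evaluation is a ring homomorphism\<close>

lemma eval_eq_sum_superset:
  assumes "finite A" "Poly_Mapping.keys f \<subseteq> A"
  shows "eval f x = (\<Sum>a\<in>A. Poly_Mapping.lookup f a * (\<Prod>i\<in>UNIV. (x $ i) ^ Poly_Mapping.lookup a i))"
  unfolding eval_def
  by (rule sum.mono_neutral_left) (use assms in \<open>auto simp: in_keys_iff\<close>)

lemma eval_zero [simp]: "eval 0 x = 0"
  by (simp add: eval_def)

lemma eval_add [simp]: "eval (f + g) x = eval f x + eval g x"
proof -
  let ?A = "Poly_Mapping.keys f \<union> Poly_Mapping.keys g"
  show ?thesis
    using keys_add[of f g]
    by (simp add: eval_eq_sum_superset[of ?A] lookup_add distrib_right sum.distrib)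
qed

lemma eval_diff [simp]: "eval (f - g) x = eval f x - eval g x"
  using eval_add[of "f - g" g x] by (simp add: algebra_simps)

lemma eval_sum [simp]: "eval (sum h A) x = (\<Sum>a\<in>A. eval (h a) x)"
  by (induction A rule: infinite_finite_induct) auto

lemma eval_single:
  "eval (Poly_Mapping.single a c) x = c * (\<Prod>i\<in>UNIV. (x $ i) ^ Poly_Mapping.lookup a i)"
  by (subst eval_eq_sum_superset[of "{a}"]) auto

lemma eval_mult [simp]: "eval (f * g) x = eval f x * eval g x"
proof -
  let ?lf = "Poly_Mapping.lookup f" and ?lg = "Poly_Mapping.lookup g"
  let ?v = "\<lambda>a. \<Prod>i\<in>UNIV. (x $ i) ^ Poly_Mapping.lookup a i"
  have v_add: "?v (a + b) = ?v a * ?v b" for a b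
    by (simp add: lookup_add power_add prod.distrib)
  have "f * g = (\<Sum>a\<in>Poly_Mapping.keys f. Poly_Mapping.single a (?lf a)) *
                (\<Sum>b\<in>Poly_Mapping.keys g. Poly_Mapping.single b (?lg b))"
    by (rule arg_cong2[OF poly_mapping_sum_single poly_mapping_sum_single])
  also have "\<dots> = (\<Sum>a\<in>Poly_Mapping.keys f. \<Sum>b\<in>Poly_Mapping.keys g.
      Poly_Mapping.single (a + b) (?lf a * ?lg b))"
    by (simp add: sum_product mult_single)
  finally have "eval (f * g) x = (\<Sum>a\<in>Poly_Mapping.keys f. \<Sum>b\<in>Poly_Mapping.keys g.
      (?lf a * ?lg b) * ?v (a + b))"
    by (simp add: eval_single)
  also have "\<dots> = (\<Sum>a\<in>Poly_Mapping.keys f. \<Sum>b\<in>Poly_Mapping.keys g.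
      (?lf a * ?v a) * (?lg b * ?v b))"
    by (simp only: v_add mult.assoc mult.left_commute)
  also have "\<dots> = eval f x * eval g x"
    by (simp add: eval_def sum_product)
  finally show ?thesis .
qed

lemma eval_const [simp]: "eval (Poly_Mapping.single 0 c) x = c"
  by (simp add: eval_single)

lemma eval_poly_scale [simp]: "eval (poly_scale c f) x = c * eval f x"
  by (simp add: poly_scale_eq_mult)

lemma eval_one [simp]: "eval 1 x = 1"
  using eval_const[of 1 x] by simp

lemma eval_prod [simp]: "eval (prod h A) x = (\<Prod>a\<in>A. eval (h a) x)"
  by (induction A rule: infinite_finite_induct) auto

lemma eval_variable:
  "eval (Poly_Mapping.single (Poly_Mapping.single k 1) 1) x = x $ k"
proof -
  have "(x $ i) ^ Poly_Mapping.lookup (Poly_Mapping.single k 1) i = (if i = k then x $ i else 1)" for i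
    by (auto simp: lookup_single when_def)
  then show ?thesis by (simp add: eval_single)
qed

lemma ideal_vanishing_ideal: "idl.subspace (vanishing_ideal X)"
  by (rule idl.subspaceI) (auto simp: vanishing_ideal_def)

lemma sum_mult_delta:
  fixes g :: "'m::finite \<Rightarrow> 'a::semiring_1"
  shows "(\<Sum>i\<in>UNIV. g i * (if j = i then 1 else 0)) = g j"
    and "(\<Sum>i\<in>UNIV. g i * (if i = j then 1 else 0)) = g j"
  by (simp_all add: if_distrib[of "(*) _"] cong: if_cong)

text \<open>
  Distinct points differ in some coordinate, hence are separated by a polynomial that is affine
  linear in that one variable. The product of these separators over all other points is 1 at a
  given point and 0 at the rest, and the interpolating polynomial is a combination of such
  products.
\<close>
lemma interpolation:
  fixes P :: "'m::finite \<Rightarrow> 'a::field ^ 't::finite" and v :: "'m \<Rightarrow> 'a"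
  assumes "inj P"
  shows "\<exists>f. \<forall>i. eval f (P i) = v i"
proof -
  have sep: "\<exists>f. eval f (P i) = 1 \<and> eval f (P j) = 0" if "i \<noteq> j" for i j
  proof -
    have "P i \<noteq> P j" using assms that by (auto dest: injD)
    then obtain k where k: "P i $ k \<noteq> P j $ k" by (auto simp: vec_eq_iff)
    let ?c = "inverse (P i $ k - P j $ k)"
    let ?f = "Poly_Mapping.single 0 ?c *
       (Poly_Mapping.single (Poly_Mapping.single k 1) 1 - Poly_Mapping.single 0 (P j $ k))"
    show ?thesis
      by (rule exI[of _ ?f]) (use k in \<open>simp only: eval_mult eval_diff eval_const eval_variable, simp\<close>)
  qed
  then obtain s where s: "eval (s i j) (P i) = 1 \<and> eval (s i j) (P j) = 0" if "i \<noteq> j" for i j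
    by metis
  define d where "d i = (\<Prod>j\<in>UNIV - {i}. s i j)" for i
  have d: "eval (d i) (P j) = (if j = i then 1 else 0)" for i j
  proof (cases "j = i")
    case True
    then show ?thesis using s by (auto simp: d_def intro!: prod.neutral)
  next
    case False
    then have "\<exists>k\<in>UNIV - {i}. eval (s i k) (P j) = 0"
      using s[of i j] by (intro bexI[of _ j]) auto
    then show ?thesis using False by (simp add: d_def prod_zero)
  qed
  have "eval (\<Sum>i\<in>UNIV. poly_scale (v i) (d i)) (P j) = v j" for j
    by (simp add: d sum_mult_delta)
  then show ?thesis by blast
qed

section \<open>Standard monomials and normal forms\<close>

text \<open>
  The definite description in the definition of the leading exponent denotes: the finitely many
  exponents of a nonzero polynomial have a largest element, unique as the order is total and
  asymmetric.
\<close>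
lemma lead_exp:
  assumes "monomial_order prec" "f \<noteq> 0"
  shows "lead_exp prec f \<in> Poly_Mapping.keys f"
    and "b \<in> Poly_Mapping.keys f \<Longrightarrow> b = lead_exp prec f \<or> prec b (lead_exp prec f)"
proof -
  have ord: "irreflp prec" "transp prec" "totalp prec"
    using assms(1) by (auto simp: monomial_order_def)
  then have asym: "asymp prec"
    by (metis asympI irreflpD transpD)
  have "\<exists>m\<in>Poly_Mapping.keys f. \<forall>b\<in>Poly_Mapping.keys f. b \<noteq> m \<longrightarrow> \<not> prec m b"
    by (rule Finite_Set.bex_max_element)
      (use asym ord assms(2) in \<open>auto intro: asymp_on_subset transp_on_subset\<close>)
  then obtain m where m: "m \<in> Poly_Mapping.keys f"
    "\<And>b. b \<in> Poly_Mapping.keys f \<Longrightarrow> b = m \<or> prec b m"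
    using ord(3) by (metis totalpD)
  have "lead_exp prec f = m"
    unfolding lead_exp_def appears_in_def
  proof (rule the_equality)
    fix a
    assume "Poly_Mapping.lookup f a \<noteq> 0 \<and> (\<forall>b. Poly_Mapping.lookup f b \<noteq> 0 \<longrightarrow> b = a \<or> prec b a)"
    then show "a = m"
      using m asym by (metis asympD in_keys_iff)
  qed (use m in \<open>auto simp: in_keys_iff\<close>)
  then show "lead_exp prec f \<in> Poly_Mapping.keys f"
    and "b \<in> Poly_Mapping.keys f \<Longrightarrow> b = lead_exp prec f \<or> prec b (lead_exp prec f)"
    using m by auto
qed

text \<open>
  The polynomials all of whose monomials are divisible by one of the generators form an ideal
  containing the generators, hence containing the whole monomial ideal.
\<close>
lemma monom_in_ideal_gen_monoms:
  fixes B :: "'t expvec set"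
  assumes "(monom a :: ('t, 'a::comm_ring_1) mpoly) \<in> ideal_gen {monom b | b. b \<in> B}"
  shows "\<exists>b\<in>B. \<exists>c. a = c + b"
proof -
  let ?M = "{c + b | b c. b \<in> B}"
  let ?T = "{f :: ('t, 'a) mpoly. Poly_Mapping.keys f \<subseteq> ?M}"
  have "ideal_gen {monom b | b. b \<in> B} \<subseteq> ?T"
    unfolding ideal_gen_def
  proof (rule idl.span_minimal)
    have "b \<in> ?M" if "b \<in> B" for b
    proof -
      have "b = 0 + b" by simp
      then show ?thesis using that by blast
    qed
    then show "{monom b | b. b \<in> B} \<subseteq> ?T"
      by (auto simp: monom_def)
    show "idl.subspace ?T"
    proof (rule idl.subspaceI)
      fix f g assume "f \<in> ?T" "g \<in> ?T"
      then show "f + g \<in> ?T" using keys_add[of f g] by blast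
    next
      fix r f assume f: "f \<in> ?T"
      have "k \<in> ?M" if k: "k \<in> Poly_Mapping.keys (r * f)" for k
      proof -
        obtain u w where "k = u + w" "w \<in> Poly_Mapping.keys f"
          using k keys_mult[of r f] by blast
        then obtain b c where "k = u + (c + b)" "b \<in> B" using f by blast
        then show ?thesis by (auto simp: add.assoc[symmetric])
      qed
      then show "r * f \<in> ?T" by blast
    qed simp
  qed
  then have "a \<in> ?M" using assms by (auto simp: monom_def)
  then show ?thesis by blast
qed

lemma not_std_monom_divisible:
  fixes I :: "('t, 'a::comm_ring_1) mpoly set"
  assumes "a \<notin> std_monoms prec I"
  obtains f c where "f \<in> I" "f \<noteq> 0" "a = c + lead_exp prec f"
proof -
  have "{monom (lead_exp prec f) | f. f \<in> I \<and> f \<noteq> 0}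
      = {monom b :: ('t, 'a) mpoly | b. b \<in> lead_exp prec ` {f \<in> I. f \<noteq> 0}}"
    by auto
  then show ?thesis
    using assms monom_in_ideal_gen_monoms[of a "lead_exp prec ` {f \<in> I. f \<noteq> 0}"] that
    by (auto simp: std_monoms_def initial_ideal_def)
qed

text \<open>
  Division with remainder, by well-founded induction on the monomial order. A nonstandard
  monomial is \<open>t\<^sup>c\<close> times the leading monomial of some \<open>f\<close> in the ideal; subtracting the matching
  multiple of \<open>t\<^sup>c f\<close> replaces it by a combination of smaller monomials. Since the
  polynomials congruent to a combination of standard monomials form a subspace, it suffices to
  treat monomials.
\<close>
lemma congruent_to_std:
  fixes I :: "('t, 'a::field) mpoly set"
  assumes ord: "monomial_order prec" and I: "idl.subspace I"
  shows "\<exists>r\<in>lin_span (std_monoms prec I). f - r \<in> I"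
proof -
  let ?L = "lin_span (std_monoms prec I) :: ('t, 'a) mpoly set"
  let ?R = "{f. \<exists>r\<in>?L. f - r \<in> I}"
  have scaleI: "poly_scale c g \<in> I" if "g \<in> I" for c g
    using that I by (simp add: poly_scale_eq_mult idl.subspace_scale)
  have sub: "mpoly.subspace ?R"
  proof (rule mpoly.subspaceI)
    show "0 \<in> ?R"
      using I idl.subspace_0 mpoly.subspace_0[OF subspace_lin_span] by force
  next
    fix f g assume "f \<in> ?R" "g \<in> ?R"
    then obtain r s where "r \<in> ?L" "f - r \<in> I" "s \<in> ?L" "g - s \<in> I" by blast
    moreover have "f + g - (r + s) = (f - r) + (g - s)" by simp
    ultimately show "f + g \<in> ?R"
      using I idl.subspace_add mpoly.subspace_add[OF subspace_lin_span]
      by (metis (mono_tags, lifting) mem_Collect_eq)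
  next
    fix c f assume "f \<in> ?R"
    then obtain r where "r \<in> ?L" "f - r \<in> I" by blast
    then show "poly_scale c f \<in> ?R"
      using scaleI[of "f - r" c] mpoly.subspace_scale[OF subspace_lin_span, of r _ c]
      by (auto simp: mpoly.scale_right_diff_distrib)
  qed
  have "monom a \<in> ?R" for a
  proof -
    have "wfp prec" using ord by (simp add: monomial_order_def)
    then show ?thesis
    proof (induction a rule: wfp_induct_rule)
      case (less a)
      show ?case
      proof (cases "a \<in> std_monoms prec I")
        case True
        then have "monom a \<in> ?L" by (simp add: lin_span_iff_keys monom_def)
        then show ?thesis using I idl.subspace_0 by force
      next
        case False
        then obtain f c where f: "f \<in> I" "f \<noteq> 0" and a: "a = c + lead_exp prec f"
          by (rule not_std_monom_divisible)
        let ?l = "lead_exp prec f"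
        let ?k = "Poly_Mapping.lookup f ?l"
        have k: "?k \<noteq> 0"
          using lead_exp(1)[OF ord f(2)] by (simp add: in_keys_iff)
        \<comment> \<open>The tail of \<open>f\<close>: shifted by \<open>c\<close>, all its exponents lie below \<open>a\<close>.\<close>
        define g where "g = f - Poly_Mapping.single ?l ?k"
        have keys_g: "prec b ?l" if "b \<in> Poly_Mapping.keys g" for b
          using that lead_exp(2)[OF ord f(2), of b]
          by (auto simp: g_def in_keys_iff lookup_minus lookup_single when_def split: if_splits)
        have "monom c * g \<in> lin_span {b. prec b a}"
          unfolding lin_span_iff_keys
        proof
          fix b assume "b \<in> Poly_Mapping.keys (monom c * g)"
          then obtain d where "b = c + d" "d \<in> Poly_Mapping.keys g"
            using keys_mult[of "monom c" g] by (auto simp: monom_def)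
          then show "b \<in> {b. prec b a}"
            using keys_g ord by (auto simp: monomial_order_def a add.commute[of c])
        qed
        also have "lin_span {b. prec b a} \<subseteq> ?R"
          unfolding lin_span_def[of "{b. prec b a}"]
          by (rule mpoly.span_minimal) (use less.IH sub in auto)
        finally have tail: "poly_scale (- inverse ?k) (monom c * g) \<in> ?R"
          by (rule mpoly.subspace_scale[OF sub])
        have head: "poly_scale (inverse ?k) (monom c * f) \<in> ?R"
          using f(1) I scaleI mpoly.subspace_0[OF subspace_lin_span]
          by (auto intro!: bexI[of _ 0] simp: idl.subspace_scale)
        have "monom a = poly_scale (inverse ?k) (monom c * f) + poly_scale (- inverse ?k) (monom c * g)"
          using k by (simp add: g_def a monom_def poly_scale_eq_mult mult_single
              single_uminus algebra_simps)
        then show ?thesis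
          using mpoly.subspace_add[OF sub head tail] by (simp only:)
      qed
    qed
  qed
  then have "lin_span UNIV \<subseteq> ?R"
    unfolding lin_span_def[of UNIV] by (intro mpoly.span_minimal sub) auto
  moreover have "f \<in> lin_span UNIV" by (simp add: lin_span_iff_keys)
  ultimately show ?thesis by blast
qed

text \<open>
  The leading monomial of a nonzero \<open>f\<close> would be standard, as a monomial of \<open>f\<close>, and in the
  initial ideal, as \<open>f\<close> is in the ideal.
\<close>
lemma lin_span_std_monoms_Int_ideal:
  assumes ord: "monomial_order prec"
    and f: "f \<in> lin_span (std_monoms prec I)" "f \<in> I"
  shows "f = 0"
proof (rule ccontr)
  assume "f \<noteq> 0"
  then have "lead_exp prec f \<in> std_monoms prec I"
    using lead_exp(1)[OF ord] f(1) by (auto simp: lin_span_iff_keys)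
  moreover have "monom (lead_exp prec f) \<in> initial_ideal prec I"
    using f(2) \<open>f \<noteq> 0\<close> unfolding initial_ideal_def ideal_gen_def
    by (intro idl.span_base) auto
  ultimately show False by (simp add: std_monoms_def)
qed

lemma normal_form:
  fixes I :: "('t, 'a::field) mpoly set"
  assumes ord: "monomial_order prec" and I: "idl.subspace I"
  shows "normal_form prec I u \<in> lin_span (std_monoms prec I)"
    and "u - normal_form prec I u \<in> I"
proof -
  have "\<exists>!r. r \<in> lin_span (std_monoms prec I) \<and> u - r \<in> I"
  proof (rule ex_ex1I)
    show "\<exists>r. r \<in> lin_span (std_monoms prec I) \<and> u - r \<in> I"
      using congruent_to_std[OF assms] by blast
  next
    fix r s
    assume "r \<in> lin_span (std_monoms prec I) \<and> u - r \<in> I"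
      and "s \<in> lin_span (std_monoms prec I) \<and> u - s \<in> I"
    moreover from this have "(u - s) - (u - r) \<in> I"
      using idl.subspace_diff[OF I] by blast
    ultimately have "r - s \<in> lin_span (std_monoms prec I)" "r - s \<in> I"
      using mpoly.subspace_diff[OF subspace_lin_span] by auto
    then show "r = s"
      using lin_span_std_monoms_Int_ideal[OF ord] by fastforce
  qed
  from theI'[OF this]
  show "normal_form prec I u \<in> lin_span (std_monoms prec I)"
    and "u - normal_form prec I u \<in> I"
    by (auto simp: normal_form_def)
qed

section \<open>Interpolation by standard monomials\<close>

lemma std_interpolation_unique:
  assumes ord: "monomial_order prec"
    and f: "f \<in> lin_span (std_monoms prec (vanishing_ideal (range P)))"
    and g: "g \<in> lin_span (std_monoms prec (vanishing_ideal (range P)))"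
    and eq: "\<And>i. eval f (P i) = eval g (P i)"
  shows "f = g"
proof -
  have "f - g = 0"
  proof (rule lin_span_std_monoms_Int_ideal[OF ord])
    show "f - g \<in> lin_span (std_monoms prec (vanishing_ideal (range P)))"
      using f g by (rule mpoly.subspace_diff[OF subspace_lin_span])
    show "f - g \<in> vanishing_ideal (range P)"
      using eq by (auto simp: vanishing_ideal_def)
  qed
  then show ?thesis by simp
qed

lemma std_interpolation:
  fixes P :: "'m::finite \<Rightarrow> 'a::field ^ 't::finite"
  assumes ord: "monomial_order prec" and "inj P"
  shows "\<exists>f\<in>lin_span (std_monoms prec (vanishing_ideal (range P))). \<forall>i. eval f (P i) = v i"
proof -
  obtain g where g: "\<And>i. eval g (P i) = v i"
    using interpolation[OF \<open>inj P\<close>] by metis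
  obtain r where "r \<in> lin_span (std_monoms prec (vanishing_ideal (range P)))"
    "g - r \<in> vanishing_ideal (range P)"
    using congruent_to_std[OF ord ideal_vanishing_ideal] by blast
  then show ?thesis using g by (auto simp: vanishing_ideal_def)
qed

lemma std_indicator:
  fixes P :: "'m::finite \<Rightarrow> 'a::field ^ 't::finite"
  assumes ord: "monomial_order prec" and "inj P"
  shows "std_indicator prec P i \<in> lin_span (std_monoms prec (vanishing_ideal (range P)))"
    and "eval (std_indicator prec P i) (P j) = (if j = i then 1 else 0)"
proof -
  let ?L = "lin_span (std_monoms prec (vanishing_ideal (range P)))"
  have "\<exists>!f. f \<in> ?L \<and> eval f (P i) = 1 \<and> (\<forall>j. j \<noteq> i \<longrightarrow> eval f (P j) = 0)"
  proof (rule ex_ex1I)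
    show "\<exists>f. f \<in> ?L \<and> eval f (P i) = 1 \<and> (\<forall>j. j \<noteq> i \<longrightarrow> eval f (P j) = 0)"
      using std_interpolation[OF assms, of "\<lambda>j. if j = i then 1 else 0"] by auto
  next
    fix f g
    assume *: "f \<in> ?L \<and> eval f (P i) = 1 \<and> (\<forall>j. j \<noteq> i \<longrightarrow> eval f (P j) = 0)"
      and **: "g \<in> ?L \<and> eval g (P i) = 1 \<and> (\<forall>j. j \<noteq> i \<longrightarrow> eval g (P j) = 0)"
    then have "eval f (P j) = eval g (P j)" for j
      by (cases "j = i") auto
    with * ** show "f = g" by (intro std_interpolation_unique[OF ord, of f P g]) blast+
  qed
  from theI'[OF this] have *: "std_indicator prec P i \<in> ?L \<and> eval (std_indicator prec P i) (P i) = 1 \<and>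
      (\<forall>j. j \<noteq> i \<longrightarrow> eval (std_indicator prec P i) (P j) = 0)"
    unfolding std_indicator_def .
  then show "std_indicator prec P i \<in> ?L" by blast
  show "eval (std_indicator prec P i) (P j) = (if j = i then 1 else 0)"
    using * by (cases "j = i") auto
qed

text \<open>
  Both sides are combinations of standard monomials with the same values at all the points, so
  they agree by the uniqueness of interpolation.
\<close>
lemma std_expansion:
  fixes P :: "'m::finite \<Rightarrow> 'a::field ^ 't::finite"
  assumes ord: "monomial_order prec" and "inj P"
    and f: "f \<in> lin_span (std_monoms prec (vanishing_ideal (range P)))"
  shows "f = (\<Sum>i\<in>UNIV. poly_scale (eval f (P i)) (std_indicator prec P i))"
proof (rule std_interpolation_unique[OF ord f])
  show "(\<Sum>i\<in>UNIV. poly_scale (eval f (P i)) (std_indicator prec P i))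
      \<in> lin_span (std_monoms prec (vanishing_ideal (range P)))"
    by (intro mpoly.subspace_sum mpoly.subspace_scale subspace_lin_span std_indicator(1) assms)
qed (simp add: std_indicator(2)[OF assms(1,2)] sum_mult_delta)

text \<open>
  A polynomial and its normal form have the same values at the points, and the normal form is
  the combination of the indicator functions with these values as coefficients. Thus every
  coefficient of the normal form is a fixed linear functional of the vector of values; for an
  exponent \<open>e\<close> that appears in all the indicator functions this functional has no zero weight.
\<close>
lemma coeff_normal_form:
  fixes P :: "'m::finite \<Rightarrow> 'a::field ^ 't::finite"
  assumes ord: "monomial_order prec" and "inj P"
  shows "Poly_Mapping.lookup (normal_form prec (vanishing_ideal (range P)) u) e
       = (\<Sum>i\<in>UNIV. Poly_Mapping.lookup (std_indicator prec P i) e * eval u (P i))"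
proof -
  let ?r = "normal_form prec (vanishing_ideal (range P)) u"
  note nf = normal_form[OF ord ideal_vanishing_ideal[of "range P"], where u = u]
  have eq: "eval ?r (P i) = eval u (P i)" for i
    using nf(2) by (simp add: vanishing_ideal_def)
  have "Poly_Mapping.lookup ?r e
      = Poly_Mapping.lookup (\<Sum>i\<in>UNIV. poly_scale (eval ?r (P i)) (std_indicator prec P i)) e"
    by (rule arg_cong[OF std_expansion[OF assms nf(1)]])
  then show ?thesis by (simp only: lookup_sum lookup_poly_scale eq mult.commute)
qed

lemma bij_betw_eval_std:
  fixes P :: "'m::finite \<Rightarrow> 'a::field ^ 't::finite"
  assumes ord: "monomial_order prec" and "inj P"
  shows "bij_betw (\<lambda>f. \<chi> i. eval f (P i))
           (lin_span (std_monoms prec (vanishing_ideal (range P)))) UNIV"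
proof (rule bij_betwI')
  let ?L = "lin_span (std_monoms prec (vanishing_ideal (range P)))"
  fix f g :: "('t, 'a) mpoly" assume "f \<in> ?L" "g \<in> ?L"
  then show "((\<chi> i. eval f (P i)) = (\<chi> i. eval g (P i))) = (f = g)"
    using std_interpolation_unique[OF ord] by (auto simp: vec_eq_iff)
next
  fix v :: "'a ^ 'm"
  show "\<exists>f\<in>lin_span (std_monoms prec (vanishing_ideal (range P))). v = (\<chi> i. eval f (P i))"
    using std_interpolation[OF assms, of "\<lambda>i. v $ i"] by (metis vec_lambda_unique)
qed simp

text \<open>
  Finiteness comes from the injection of the standard monomials into their span, a finite set
  since evaluation embeds it into \<open>K\<^sup>m\<close>; counting both sides of the bijection then gives
  \<open>q\<^bsup>|\<Delta>|\<^esup> = q\<^sup>m\<close> with \<open>q = |K| > 1\<close>.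
\<close>
lemma card_std_monoms:
  fixes P :: "'m::finite \<Rightarrow> 'a::{field,finite} ^ 't::finite"
  assumes ord: "monomial_order prec" and "inj P"
  shows "finite (std_monoms prec (vanishing_ideal (range P)))"
    and "card (std_monoms prec (vanishing_ideal (range P))) = CARD('m)"
proof -
  let ?D = "std_monoms prec (vanishing_ideal (range P))"
  note bij = bij_betw_eval_std[OF assms]
  have "finite (lin_span ?D :: ('t, 'a) mpoly set)"
    using bij_betw_finite[OF bij] by simp
  moreover have "monom ` ?D \<subseteq> (lin_span ?D :: ('t, 'a) mpoly set)"
    by (auto simp: lin_span_iff_keys monom_def)
  moreover have "inj_on (monom :: _ \<Rightarrow> ('t, 'a) mpoly) ?D"
    by (rule inj_onI) (auto simp: monom_def dest: arg_cong[where f = Poly_Mapping.keys])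
  ultimately show fin: "finite ?D"
    using finite_imageD finite_subset by blast
  have "CARD('a) ^ card ?D = CARD('a) ^ CARD('m)"
    using bij_betw_same_card[OF bij] card_lin_span[OF fin, where 'a = 'a]
    by simp
  moreover have "1 < CARD('a)"
    using card_mono[of UNIV "{0, 1 :: 'a}"] by simp
  ultimately show "card ?D = CARD('m)"
    by (metis power_inject_exp)
qed

section \<open>Evaluation codes, their duals, and the duality theorem\<close>

lemma card_eval_code:
  fixes P :: "'m::finite \<Rightarrow> 'a::{field,finite} ^ 't::finite"
  assumes ord: "monomial_order prec" and "inj P"
    and \<Gamma>: "\<Gamma> \<subseteq> std_monoms prec (vanishing_ideal (range P))"
  shows "card (eval_code P (lin_span \<Gamma>)) = CARD('a) ^ card \<Gamma>"
proof -
  let ?D = "std_monoms prec (vanishing_ideal (range P))"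
  have "lin_span \<Gamma> \<subseteq> (lin_span ?D :: ('t, 'a) mpoly set)"
    using \<Gamma> by (auto simp: lin_span_iff_keys)
  then have "inj_on (\<lambda>f. \<chi> i. eval f (P i)) (lin_span \<Gamma>)"
    using bij_betw_eval_std[OF assms(1,2)] by (meson bij_betw_imp_inj_on inj_on_subset)
  moreover have "eval_code P (lin_span \<Gamma>) = (\<lambda>f. \<chi> i. eval f (P i)) ` lin_span \<Gamma>"
    by (auto simp: eval_code_def)
  moreover have "finite \<Gamma>"
    using \<Gamma> card_std_monoms(1)[OF assms(1,2)] by (rule finite_subset)
  ultimately show ?thesis by (simp add: card_image card_lin_span)
qed

text \<open>
  Lets orthogonality relations be checked on monomials and extended to their span by
  \<open>mpoly.span_minimal\<close>.
\<close>
lemma subspace_orthogonal_polys: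
  "mpoly.subspace {f. (\<Sum>i\<in>UNIV. w i * eval f (P i)) = 0}"
proof -
  have "(\<Sum>i\<in>UNIV. w i * (c * eval f (P i))) = c * (\<Sum>i\<in>UNIV. w i * eval f (P i))" for c f
    by (simp add: sum_distrib_left mult_ac)
  then show ?thesis
    by (intro mpoly.subspaceI) (simp_all add: distrib_left sum.distrib)
qed

text \<open>
  The evaluations of the standard monomials span \<open>K\<^sup>m\<close>, so a vector is determined by its inner
  products with them. For a vector in the dual of the code of \<open>\<Gamma>\<close> the products with the
  monomials in \<open>\<Gamma>\<close> vanish, which leaves only \<open>m - |\<Gamma>|\<close> free values.
\<close>
lemma card_dual_eval_code_le:
  fixes P :: "'m::finite \<Rightarrow> 'a::{field,finite} ^ 't::finite"
  assumes ord: "monomial_order prec" and "inj P"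
    and \<Gamma>: "\<Gamma> \<subseteq> std_monoms prec (vanishing_ideal (range P))"
  shows "card (dual_code (eval_code P (lin_span \<Gamma>))) \<le> CARD('a) ^ (CARD('m) - card \<Gamma>)"
proof -
  let ?D = "std_monoms prec (vanishing_ideal (range P))"
  let ?s = "\<lambda>v a. \<Sum>i\<in>UNIV. v $ i * eval (monom a) (P i)"
  let ?C = "dual_code (eval_code P (lin_span \<Gamma>))"
  note finD = card_std_monoms(1)[OF assms(1,2)]
  have zero: "?s v a = 0" if "v \<in> ?C" "a \<in> \<Gamma>" for v a
  proof -
    have "monom a \<in> lin_span \<Gamma>" using that(2) by (simp add: lin_span_iff_keys monom_def)
    then show ?thesis using that(1) by (force simp: dual_code_def eval_code_def)
  qed
  have "inj_on (\<lambda>v. restrict (?s v) (?D - \<Gamma>)) ?C"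
  proof (rule inj_onI)
    fix v w assume v: "v \<in> ?C" and w: "w \<in> ?C"
      and eq: "restrict (?s v) (?D - \<Gamma>) = restrict (?s w) (?D - \<Gamma>)"
    have "?s v a = ?s w a" if "a \<in> ?D" for a
    proof (cases "a \<in> \<Gamma>")
      case True
      then show ?thesis using zero v w by simp
    next
      case False
      then show ?thesis using fun_cong[OF eq, of a] that by simp
    qed
    \<comment> \<open>Equal products with all standard monomials make \<open>v - w\<close> orthogonal to the values of
      the indicator functions, which are the unit vectors.\<close>
    then have "lin_span ?D \<subseteq> {f. (\<Sum>i\<in>UNIV. (v $ i - w $ i) * eval f (P i)) = 0}"
      unfolding lin_span_def
      by (intro mpoly.span_minimal subspace_orthogonal_polys)
        (auto simp: left_diff_distrib sum_subtractf)
    then have "(\<Sum>i\<in>UNIV. (v $ i - w $ i) * eval (std_indicator prec P j) (P i)) = 0" for j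
      using std_indicator(1)[OF assms(1,2)] by blast
    then show "v = w"
      by (simp add: std_indicator(2)[OF assms(1,2)] vec_eq_iff sum_mult_delta)
  qed
  then have "card ?C \<le> card ((?D - \<Gamma>) \<rightarrow>\<^sub>E (UNIV :: 'a set))"
    by (rule card_inj_on_le) (use finD in \<open>auto intro!: finite_PiE split: if_splits\<close>)
  then show ?thesis
    using finD \<Gamma> card_std_monoms(2)[OF assms(1,2)]
    by (simp add: card_funcsetE card_Diff_subset finite_subset)
qed

theorem theorem5p4:
  fixes P :: "'m::finite \<Rightarrow> 'a::{field,finite} ^ 't::finite"
    and X :: "('a ^ 't) set"
    and I :: "('t, 'a) mpoly set"
    and prec :: "'t expvec \<Rightarrow> 't expvec \<Rightarrow> bool"
    and e :: "'t expvec"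
    and \<Gamma>1 \<Gamma>2 :: "'t expvec set"
  assumes "inj P" and "X = range P" and "card X \<ge> 2"
    and "I = vanishing_ideal X"
    and "monomial_order prec"
    and "e \<in> std_monoms prec I" and "essential_monom prec P e"
    and "\<Gamma>1 \<subseteq> std_monoms prec I" and "\<Gamma>2 \<subseteq> std_monoms prec I"
    and "card \<Gamma>1 + card \<Gamma>2 = card X"
    and "\<And>u. u \<in> monom_products \<Gamma>1 \<Gamma>2 \<Longrightarrow> \<not> appears_in e (normal_form prec I u)"
  shows "\<exists>\<beta> :: 'a ^ 'm.
      (\<forall>i. \<beta> $ i \<noteq> 0) \<and>
      scale_code \<beta> (eval_code P (lin_span \<Gamma>1)) = dual_code (eval_code P (lin_span \<Gamma>2)) \<and>
      (\<forall>i. \<beta> $ i = Poly_Mapping.lookup (std_indicator prec P i) e)"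
proof -
  define \<beta> :: "'a ^ 'm" where "\<beta> = (\<chi> i. Poly_Mapping.lookup (std_indicator prec P i) e)"
  let ?C1 = "eval_code P (lin_span \<Gamma>1)" and ?C2 = "eval_code P (lin_span \<Gamma>2)"
  have I: "I = vanishing_ideal (range P)" using assms(2,4) by simp
  note ord = \<open>monomial_order prec\<close>
  have \<beta>_nz: "\<beta> $ i \<noteq> 0" for i
    using \<open>essential_monom prec P e\<close> by (simp add: \<beta>_def essential_monom_def appears_in_def)
  have orth_monom: "(\<Sum>i\<in>UNIV. \<beta> $ i * eval (monom a) (P i) * eval (monom b) (P i)) = 0"
    if "a \<in> \<Gamma>1" "b \<in> \<Gamma>2" for a b
  proof -
    have "monom a * monom b \<in> (monom_products \<Gamma>1 \<Gamma>2 :: ('t, 'a) mpoly set)"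
      using that by (auto simp: monom_products_def)
    then have "Poly_Mapping.lookup (normal_form prec I (monom a * monom b)) e = 0"
      using assms(11) by (simp add: appears_in_def)
    then show ?thesis
      by (simp add: I coeff_normal_form[OF ord \<open>inj P\<close>] \<beta>_def mult.assoc)
  qed
  \<comment> \<open>Bilinearity extends the relation from monomials to the spans, one factor at a time.\<close>
  have orth1: "(\<Sum>i\<in>UNIV. \<beta> $ i * eval f (P i) * eval (monom b) (P i)) = 0"
    if "f \<in> lin_span \<Gamma>1" "b \<in> \<Gamma>2" for f b
  proof -
    have "lin_span \<Gamma>1 \<subseteq> {f. (\<Sum>i\<in>UNIV. (\<beta> $ i * eval (monom b) (P i)) * eval f (P i)) = 0}"
      unfolding lin_span_def
      by (intro mpoly.span_minimal subspace_orthogonal_polys)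
        (use orth_monom that(2) in \<open>auto simp: mult_ac\<close>)
    then show ?thesis using that(1) by (auto simp: mult_ac)
  qed
  have orth: "(\<Sum>i\<in>UNIV. (\<beta> $ i * eval f (P i)) * eval g (P i)) = 0"
    if "f \<in> lin_span \<Gamma>1" "g \<in> lin_span \<Gamma>2" for f g
  proof -
    have "lin_span \<Gamma>2 \<subseteq> {g. (\<Sum>i\<in>UNIV. (\<beta> $ i * eval f (P i)) * eval g (P i)) = 0}"
      unfolding lin_span_def
      by (intro mpoly.span_minimal subspace_orthogonal_polys)
        (use orth1 that(1) in auto)
    then show ?thesis using that(2) by auto
  qed
  have sub: "scale_code \<beta> ?C1 \<subseteq> dual_code ?C2"
    by (auto simp: scale_code_def dual_code_def eval_code_def orth)
  have "card X = CARD('m)"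
    using assms(1,2) by (simp add: card_image)
  then have "card \<Gamma>1 = CARD('m) - card \<Gamma>2"
    using assms(10) by simp
  then have "card (dual_code ?C2) \<le> CARD('a) ^ card \<Gamma>1"
    using card_dual_eval_code_le[OF ord \<open>inj P\<close>, of \<Gamma>2] assms(9) by (simp add: I)
  also have "\<dots> = card ?C1"
    using card_eval_code[OF ord \<open>inj P\<close>, of \<Gamma>1] assms(8) by (simp add: I)
  also have "\<dots> = card (scale_code \<beta> ?C1)"
  proof -
    have "inj_on (\<lambda>c. \<chi> i. \<beta> $ i * c $ i) ?C1"
      using \<beta>_nz by (auto simp: inj_on_def vec_eq_iff)
    moreover have "scale_code \<beta> ?C1 = (\<lambda>c. \<chi> i. \<beta> $ i * c $ i) ` ?C1"
      by (auto simp: scale_code_def)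
    ultimately show ?thesis by (simp add: card_image)
  qed
  finally have "scale_code \<beta> ?C1 = dual_code ?C2"
    using sub by (intro card_seteq) auto
  then show ?thesis
    using \<beta>_nz by (intro exI[of _ \<beta>]) (auto simp: \<beta>_def)
qed

end
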